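(* Let $\epsilon>0$, let the step size be $\eta=\frac{1}{6L}$, let $b\in[1,n]$ denote the minibatch size, and let the epoch length be $m=\sqrt{b}$. Then, for a suitable number $S$ of epochs, the point $\hat{x}$ returned by the ProxSVRG+ algorithm is an $\epsilon$-accurate solution for the problem $\min_x \Phi(x)=f(x)+h(x)$, i.e. $\mathbb{E}[\|\mathcal{G}_\eta(\hat{x})\|^2]\le\epsilon$, with the following oracle complexity in the two cases below. 1) Let the batch size be $B=n$. The number of SFO calls is at most $$36L\big(\Phi(x_0)-\Phi(x^* )\big)\Big(\frac{B}{\epsilon\sqrt{b}}+\frac{b}{\epsilon}\Big)=O\Big(\frac{n}{\epsilon\sqrt{b}}+\frac{b}{\epsilon}\Big).$$ 2) Assume that $\mathbb{E}[\|\nabla f_i(x)-\nabla f(x)\|^2]\le\sigma^2$ for all $x$, where $\sigma>0$ is a constant and the expectation is over $i$ uniform in $[n]$. Let the batch size be $B=\min\{6\sigma^2/\epsilon,\,n\}$. The number of SFO calls is at most $$36L\big(\Phi(x_0)-\Phi(x^* )\big)\Big(\frac{B}{\epsilon\sqrt{b}}+\frac{b}{\epsilon}\Big)=O\Big(\big(n\wedge\tfrac{1}{\epsilon}\big)\frac{1}{\epsilon\sqrt{b}}+\frac{b}{\epsilon}\Big),$$ where $\wedge$ denotes the minimum. In both cases, the number of PO calls equals the total number of iterations $T=Sm$, which is at most $$\frac{36L}{\epsilon}\big(\Phi(x_0)-\Phi(x^* )\big)=O\Big(\frac{1}{\epsilon}\Big).$$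
   Context: Problem: minimize $\Phi(x):=f(x)+h(x)$ over $x\in\mathbb{R}^d$, where $f(x)=\frac1n\sum_{i=1}^n f_i(x)$. Each $f_i:\mathbb{R}^d\to\mathbb{R}$ is differentiable, possibly nonconvex, with $L$-Lipschitz gradient: $\|\nabla f_i(x)-\nabla f_i(y)\|\le L\|x-y\|$ for all $x,y$ (Euclidean norm, $L>0$). The function $h:\mathbb{R}^d\to\mathbb{R}\cup\{+\infty\}$ is convex, possibly nonsmooth (e.g. an $\ell_1$ norm or the indicator function of a convex set), proper, and such that its proximal operator $$\mathrm{prox}_{\eta h}(x):=\arg\min_{y\in\mathbb{R}^d}\Big(h(y)+\frac{1}{2\eta}\|y-x\|^2\Big)$$ is well defined. $x^*$ denotes a global minimizer of $\Phi$. $[n]=\{1,\dots,n\}$. Gradient mapping: $\mathcal{G}_\eta(x):=\frac1\eta\big(x-\mathrm{prox}_{\eta h}(x-\eta\nabla f(x))\big)$. A point $\hat{x}$ returned by a stochastic algorithm is an $\epsilon$-accurate solution if $\mathbb{E}[\|\mathcal{G}_\eta(\hat{x})\|^2]\le\epsilon$. Algorithm ProxSVRG+ (inputs: initial point $x_0$, batch size $B$, minibatch size $b$, epoch length $m$, step size $\eta$, number of epochs $S$): set $\widetilde{x}^0=x_0$. For $s=1,\dots,S$: set $x_0^s=\widetilde{x}^{s-1}$ and $g^s=\frac1B\sum_{j\in I_B}\nabla f_j(\widetilde{x}^{s-1})$; for $t=1,\dots,m$ set $$v_{t-1}^s=\frac1b\sum_{i\in I_b}\big(\nabla f_i(x_{t-1}^s)-\nabla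 f_i(\widetilde{x}^{s-1})\big)+g^s,\qquad x_t^s=\mathrm{prox}_{\eta h}(x_{t-1}^s-\eta v_{t-1}^s);$$ then set $\widetilde{x}^s=x_m^s$. Output $\hat{x}$ chosen uniformly at random from $\{x_{t-1}^s\}_{t\in[m],\,s\in[S]}$. Here $I_b$ (drawn afresh at each inner iteration) consists of $b$ independent uniform indices from $[n]$; $I_B$ (drawn afresh at each epoch) consists of $B$ independent uniform indices from $[n]$ if $B<n$, and $g^s=\nabla f(\widetilde{x}^{s-1})$ if $B=n$; all samples are mutually independent. Oracles: a stochastic first-order oracle (SFO) call at $x$ returns a stochastic gradient $\nabla f_i(x)$ with $\mathbb{E}_{i\sim[n]}[\nabla f_i(x)]=\nabla f(x)$; a proximal oracle (PO) call at $x$ returns $\mathrm{prox}_{\eta h}(x)$. SFO calls are counted as $B$ per epoch plus $b$ per inner iteration, i.e. $SB+Smb$ in total; one PO call is made per inner iteration. The quantities $m=\sqrt b$, $B$, $S$ are treated as positive integers (rounding is ignored). The $O(\cdot)$ notation hides factors depending only on $L$, $\Phi(x_0)-\Phi(x^* )$ and $\sigma$.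
   Formalization: The formal theorem additionally assumes 36L(Φ(x_0)−Φ(x* ))/(ε√b) ≥ 1; otherwise (e.g. x_0 = x* ) no positive integer S of epochs can satisfy the claimed bound T = Sm ≤ 36L(Φ(x_0)−Φ(x* ))/ε. *)

theory Defs
  imports "HOL-Probability.Probability"
begin

definition gradient :: "('a::real_inner \<Rightarrow> real) \<Rightarrow> 'a \<Rightarrow> 'a" where
  "gradient f x = (THE D. GDERIV f x :> D)"

definition average :: "nat \<Rightarrow> (nat \<Rightarrow> 'a \<Rightarrow> real) \<Rightarrow> 'a \<Rightarrow> real" where
  "average n fs x = (1 / real n) * (\<Sum>i=1..n. fs i x)"

definition objective :: "nat \<Rightarrow> (nat \<Rightarrow> 'a \<Rightarrow> real) \<Rightarrow> ('a \<Rightarrow> ereal) \<Rightarrow> 'a \<Rightarrow> ereal" where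
  "objective n fs h x = ereal (average n fs x) + h x"

definition proper_fun :: "('a \<Rightarrow> ereal) \<Rightarrow> bool" where
  "proper_fun h \<longleftrightarrow> (\<forall>x. h x \<noteq> -\<infinity>) \<and> (\<exists>x. h x \<noteq> \<infinity>)"

(* On ereal, 0 * \<infinity> = 0, so the boundary cases t = 0 and t = 1 impose nothing. *)
definition convex_fun :: "('a::real_vector \<Rightarrow> ereal) \<Rightarrow> bool" where
  "convex_fun h \<longleftrightarrow> (\<forall>x y. \<forall>t\<in>{0..1::real}.
     h ((1 - t) *\<^sub>R x + t *\<^sub>R y) \<le> ereal (1 - t) * h x + ereal t * h y)"

definition prox_objective :: "real \<Rightarrow> ('a::real_normed_vector \<Rightarrow> ereal) \<Rightarrow> 'a \<Rightarrow> 'a \<Rightarrow> ereal" where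
  "prox_objective \<eta> h x y = h y + ereal (1 / (2 * \<eta>) * (norm (y - x))\<^sup>2)"

definition prox_well_defined :: "real \<Rightarrow> ('a::real_normed_vector \<Rightarrow> ereal) \<Rightarrow> bool" where
  "prox_well_defined \<eta> h \<longleftrightarrow> (\<forall>x. \<exists>!y. is_arg_min (prox_objective \<eta> h x) (\<lambda>_. True) y)"

definition prox :: "real \<Rightarrow> ('a::real_normed_vector \<Rightarrow> ereal) \<Rightarrow> 'a \<Rightarrow> 'a" where
  "prox \<eta> h x = arg_min (prox_objective \<eta> h x) (\<lambda>_. True)"

definition gradient_mapping ::
    "real \<Rightarrow> ('a::real_inner \<Rightarrow> real) \<Rightarrow> ('a \<Rightarrow> ereal) \<Rightarrow> 'a \<Rightarrow> 'a" where
  "gradient_mapping \<eta> f h x = (1 / \<eta>) *\<^sub>R (x - prox \<eta> h (x - \<eta> *\<^sub>R gradient f x))"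

primrec iterate_pmf :: "nat \<Rightarrow> ('s \<Rightarrow> 's pmf) \<Rightarrow> 's \<Rightarrow> 's pmf" where
  "iterate_pmf 0 K s = return_pmf s"
| "iterate_pmf (Suc k) K s = bind_pmf (iterate_pmf k K s) K"

(* A sample of k independent uniform indices; a list, so that repeated indices count repeatedly. *)
definition sample :: "nat \<Rightarrow> nat \<Rightarrow> nat list pmf" where
  "sample n k = replicate_pmf k (pmf_of_set {1..n})"

(* visited collects the points from which inner steps were taken, i.e. x_(t-1)^s in order of
   generation, without the last point x_m^s of an epoch (which reappears as x_0^(s+1)).
   sfo_calls and po_calls count the oracle calls made so far. *)
record 'a svrg_state =
  current :: 'a
  visited :: "'a list"
  sfo_calls :: nat
  po_calls :: nat

definition snapshot_gradient ::
    "nat \<Rightarrow> (nat \<Rightarrow> 'a::real_inner \<Rightarrow> real) \<Rightarrow> nat \<Rightarrow> 'a \<Rightarrow> 'a pmf" where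
  "snapshot_gradient n fs B y =
     (if B = n then return_pmf (gradient (average n fs) y)
      else map_pmf (\<lambda>J. (1 / real B) *\<^sub>R (\<Sum>j\<leftarrow>J. gradient (fs j) y)) (sample n B))"

(* An inner step is charged b SFO calls, although it uses minibatch gradients both at the
   current point and at the snapshot y. *)
definition inner_step ::
    "nat \<Rightarrow> (nat \<Rightarrow> 'a::real_inner \<Rightarrow> real) \<Rightarrow> ('a \<Rightarrow> ereal) \<Rightarrow> real \<Rightarrow> nat \<Rightarrow> 'a \<Rightarrow> 'a
      \<Rightarrow> 'a svrg_state \<Rightarrow> 'a svrg_state pmf" where
  "inner_step n fs h \<eta> b y g st = do {
     I \<leftarrow> sample n b;
     let x = current st;
     let v = (1 / real b) *\<^sub>R (\<Sum>i\<leftarrow>I. gradient (fs i) x - gradient (fs i) y) + g;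
     return_pmf \<lparr> current = prox \<eta> h (x - \<eta> *\<^sub>R v), visited = visited st @ [x],
                  sfo_calls = sfo_calls st + b, po_calls = po_calls st + 1 \<rparr>
   }"

definition epoch ::
    "nat \<Rightarrow> (nat \<Rightarrow> 'a::real_inner \<Rightarrow> real) \<Rightarrow> ('a \<Rightarrow> ereal) \<Rightarrow> real \<Rightarrow> nat \<Rightarrow> nat \<Rightarrow> nat
      \<Rightarrow> 'a svrg_state \<Rightarrow> 'a svrg_state pmf" where
  "epoch n fs h \<eta> B b m st = do {
     let y = current st;
     g \<leftarrow> snapshot_gradient n fs B y;
     iterate_pmf m (inner_step n fs h \<eta> b y g) (st \<lparr> sfo_calls := sfo_calls st + B \<rparr>)
   }"

(* Joint distribution of the output point and of the numbers of SFO and PO calls. The output is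
   uniform over the indices (s, t) of the visited iterates, not over the set of distinct points. *)
definition prox_svrg_plus ::
    "nat \<Rightarrow> (nat \<Rightarrow> 'a::real_inner \<Rightarrow> real) \<Rightarrow> ('a \<Rightarrow> ereal) \<Rightarrow> 'a \<Rightarrow> nat \<Rightarrow> nat \<Rightarrow> nat \<Rightarrow> real \<Rightarrow> nat
      \<Rightarrow> ('a \<times> nat \<times> nat) pmf" where
  "prox_svrg_plus n fs h x0 B b m \<eta> S = do {
     st \<leftarrow> iterate_pmf S (epoch n fs h \<eta> B b m)
             \<lparr> current = x0, visited = [], sfo_calls = 0, po_calls = 0 \<rparr>;
     k \<leftarrow> pmf_of_set {..<length (visited st)};
     return_pmf (visited st ! k, sfo_calls st, po_calls st)
   }"

definition eps_accurate ::
    "real \<Rightarrow> real \<Rightarrow> ('a::real_inner \<Rightarrow> real) \<Rightarrow> ('a \<Rightarrow> ereal) \<Rightarrow> 'a pmf \<Rightarrow> bool" where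
  "eps_accurate \<epsilon> \<eta> f h X \<longleftrightarrow>
     measure_pmf.expectation X (\<lambda>x. (norm (gradient_mapping \<eta> f h x))\<^sup>2) \<le> \<epsilon>"

(* O[all_params] is a bound with one constant for all admissible (n, b, \<epsilon>) at once. *)
definition all_params :: "(nat \<times> nat \<times> real) filter" where
  "all_params = principal {(n, b, \<epsilon>). 1 \<le> b \<and> b \<le> n \<and> 0 < \<epsilon>}"

end

theory Submission
  imports Defs
begin

text \<open>
  Write \<open>\<Phi> = f + h\<close> and let \<open>G x\<close> be the gradient mapping at \<open>x\<close>. A proximal step from \<open>x\<close>
  along an inexact gradient \<open>v\<close> leads to a point \<open>x'\<close>. Comparing \<open>x'\<close> with the point \<open>z\<close> that
  the exact gradient would have produced, through the strong convexity of both proximal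
  subproblems and the descent inequality for \<open>f\<close>, gives
    \<open>\<Phi> x' + \<eta>/2 |G x|\<^sup>2 + 5L/2 |x' - x|\<^sup>2 \<le> \<Phi> x + \<eta>/2 |v - \<nabla>f x|\<^sup>2\<close>
  (\<open>prox_step_descent\<close>), exactly as for smooth gradient descent: the error term
  \<open>\<langle>v - \<nabla>f x, z - x'\<rangle>\<close> is absorbed by the strong convexity term \<open>|z - x'|\<^sup>2 / (2\<eta>)\<close>, at the price
  of \<open>\<eta>/2 |v - \<nabla>f x|\<^sup>2\<close> only.

  The variance reduced estimator has mean square error at most
  \<open>(L\<^sup>2/b) |x - y|\<^sup>2 + |g - \<nabla>f y|\<^sup>2\<close>, where \<open>y\<close> is the snapshot of the epoch and \<open>g\<close> its gradient
  estimate (\<open>expectation_estimator_error\<close>). The first part is paid for by the progress terms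
  \<open>5L/2 |x' - x|\<^sup>2\<close>: an epoch has only \<open>m = \<surd>b\<close> steps, so the iterates cannot drift far from \<open>y\<close>
  without making long steps. This trade is made by adding to \<open>\<Phi>\<close> a multiple of \<open>|x - y|\<^sup>2\<close> whose
  weight decreases linearly to \<open>0\<close> over the epoch (\<open>inner_loop_drift\<close>). Summing over all
  \<open>T = S m\<close> steps, the uniformly chosen iterate satisfies
    \<open>E |G|\<^sup>2 \<le> 12 L \<Delta> / T + \<tau>\<close>,
  where \<open>\<tau>\<close> bounds the mean square error of the snapshot gradient: \<open>0\<close> for a full batch and
  \<open>\<sigma>\<^sup>2/B = \<epsilon>/6\<close> for a sampled batch of size \<open>B = 6\<sigma>\<^sup>2/\<epsilon>\<close> (\<open>expected_gradient_mapping_le\<close>).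

  The number of epochs is an integer and the bound on the oracle calls must hold exactly, so
  \<open>S\<close> is \<open>36 L \<Delta> / (\<epsilon> m)\<close> rounded down. Rounding down a number that is at least \<open>1\<close> loses less
  than half of it, hence \<open>T > 18 L \<Delta> / \<epsilon>\<close> and \<open>E |G|\<^sup>2 \<le> 2\<epsilon>/3 + \<epsilon>/6 < \<epsilon>\<close>. This is where the
  constant \<open>12\<close> matters: a bound \<open>18 L \<Delta> / T + 3 \<sigma>\<^sup>2 / B\<close> would only be sufficient without rounding.
\<close>

section \<open>Expectations over finitely supported chains\<close>

lemma expectation_bind_finite:
  fixes V :: "'b \<Rightarrow> real"
  assumes "finite (set_pmf p)" "\<And>x. x \<in> set_pmf p \<Longrightarrow> finite (set_pmf (K x))"
  shows "measure_pmf.expectation (bind_pmf p K) V =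
         measure_pmf.expectation p (\<lambda>x. measure_pmf.expectation (K x) V)"
proof -
  have "measure_pmf.expectation (bind_pmf p K) V =
        (\<Sum>a\<in>set_pmf p. pmf p a *\<^sub>R measure_pmf.expectation (K a) V)"
    using assms by (intro pmf_expectation_bind) auto
  also have "\<dots> = measure_pmf.expectation p (\<lambda>x. measure_pmf.expectation (K x) V)"
    using assms by (intro integral_measure_pmf[symmetric]) auto
  finally show ?thesis .
qed

lemma expectation_mono_finite:
  fixes V W :: "'a \<Rightarrow> real"
  assumes "finite (set_pmf p)" "\<And>x. x \<in> set_pmf p \<Longrightarrow> V x \<le> W x"
  shows "measure_pmf.expectation p V \<le> measure_pmf.expectation p W"
  using assms by (intro integral_mono_AE integrable_measure_pmf_finite) (auto simp: AE_measure_pmf_iff)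

text \<open>The predicate depends on the number of steps made, so that it can record exact call counts.\<close>

lemma iterate_pmf_finite_invariant:
  assumes "P 0 s"
    and "\<And>t s. t < k \<Longrightarrow> P t s \<Longrightarrow> finite (set_pmf (K s)) \<and> (\<forall>s'\<in>set_pmf (K s). P (Suc t) s')"
  shows "finite (set_pmf (iterate_pmf k K s)) \<and> (\<forall>s'\<in>set_pmf (iterate_pmf k K s). P k s')"
  using assms(2)
proof (induction k)
  case 0
  then show ?case using assms(1) by simp
next
  case (Suc k)
  have "finite (set_pmf (iterate_pmf k K s)) \<and> (\<forall>s'\<in>set_pmf (iterate_pmf k K s). P k s')"
    by (intro Suc.IH) (rule Suc.prems, auto)
  with Suc.prems[of k] show ?case by auto
qed

text \<open>The supermartingale argument for a potential that may depend on time: a drift bound that holds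
at every reachable state adds up along the chain. The invariant says which states are reachable
after \<open>t\<close> steps.\<close>

lemma iterate_pmf_expectation_le:
  fixes V :: "nat \<Rightarrow> 's \<Rightarrow> real"
  assumes "P 0 s"
    and step: "\<And>t s. t < k \<Longrightarrow> P t s \<Longrightarrow>
      finite (set_pmf (K s)) \<and> (\<forall>s'\<in>set_pmf (K s). P (Suc t) s')"
    and drift: "\<And>t s. t < k \<Longrightarrow> P t s \<Longrightarrow>
      measure_pmf.expectation (K s) (V (Suc t)) \<le> V t s + \<delta>"
  shows "measure_pmf.expectation (iterate_pmf k K s) (V k) \<le> V 0 s + real k * \<delta>"
  using step drift
proof (induction k)
  case 0
  then show ?case by simp
next
  case (Suc k)
  let ?p = "iterate_pmf k K s"
  have inv: "finite (set_pmf ?p)" "\<And>s'. s' \<in> set_pmf ?p \<Longrightarrow> P k s'"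
  proof -
    have "finite (set_pmf ?p) \<and> (\<forall>s'\<in>set_pmf ?p. P k s')"
      using assms(1) by (rule iterate_pmf_finite_invariant) (rule Suc.prems, auto)
    then show "finite (set_pmf ?p)" "\<And>s'. s' \<in> set_pmf ?p \<Longrightarrow> P k s'" by auto
  qed
  have "measure_pmf.expectation (iterate_pmf (Suc k) K s) (V (Suc k)) =
        measure_pmf.expectation ?p (\<lambda>s. measure_pmf.expectation (K s) (V (Suc k)))"
    using inv Suc.prems(1)[of k] by (simp add: expectation_bind_finite)
  also have "\<dots> \<le> measure_pmf.expectation ?p (\<lambda>s. V k s + \<delta>)"
    using inv Suc.prems(2) by (intro expectation_mono_finite) auto
  also have "\<dots> = measure_pmf.expectation ?p (V k) + \<delta>"
    using inv by (simp add: integrable_measure_pmf_finite)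
  also have "measure_pmf.expectation ?p (V k) \<le> V 0 s + real k * \<delta>"
    by (rule Suc.IH; rule Suc.prems; simp)
  finally show ?case by (simp add: algebra_simps)
qed

section \<open>Mean square error of minibatch averages\<close>

lemma finite_set_pmf_sample: "n > 0 \<Longrightarrow> finite (set_pmf (sample n k))"
  unfolding sample_def by (induction k) auto

lemma expectation_uniform:
  fixes F :: "nat \<Rightarrow> real"
  shows "n > 0 \<Longrightarrow> measure_pmf.expectation (pmf_of_set {1..n}) F = (\<Sum>i=1..n. F i) / real n"
  by (subst integral_pmf_of_set) auto

text \<open>Independent centred summands are orthogonal in mean square. The offset \<open>c\<close> makes the induction
work: the first sampled summand is moved into it.\<close>

lemma expectation_norm_sum_sample:
  fixes \<zeta> :: "nat \<Rightarrow> 'a::real_inner"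
  assumes n: "n > 0" and mean: "(\<Sum>i=1..n. \<zeta> i) = 0"
  shows "measure_pmf.expectation (sample n k) (\<lambda>I. (norm (c + (\<Sum>i\<leftarrow>I. \<zeta> i)))\<^sup>2) =
         (norm c)\<^sup>2 + real k * measure_pmf.expectation (pmf_of_set {1..n}) (\<lambda>i. (norm (\<zeta> i))\<^sup>2)"
proof (induction k arbitrary: c)
  case 0
  then show ?case by (simp add: sample_def)
next
  case (Suc k)
  let ?u = "pmf_of_set {1..n}" and ?V = "measure_pmf.expectation (pmf_of_set {1..n}) (\<lambda>i. (norm (\<zeta> i))\<^sup>2)"
  have fin: "finite (set_pmf (sample n k))" "finite (set_pmf ?u)"
    using n by (auto simp: finite_set_pmf_sample)
  have sq: "(norm (c + \<zeta> i))\<^sup>2 = (norm c)\<^sup>2 + 2 * (c \<bullet> \<zeta> i) + (norm (\<zeta> i))\<^sup>2" for i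
    by (simp add: power2_norm_eq_inner algebra_simps inner_commute)
  have "measure_pmf.expectation (sample n (Suc k)) (\<lambda>I. (norm (c + (\<Sum>i\<leftarrow>I. \<zeta> i)))\<^sup>2) =
        measure_pmf.expectation ?u (\<lambda>i. measure_pmf.expectation (sample n k)
          (\<lambda>I. (norm ((c + \<zeta> i) + (\<Sum>j\<leftarrow>I. \<zeta> j)))\<^sup>2))"
    unfolding sample_def replicate_pmf.simps
    using fin by (simp add: expectation_bind_finite sample_def add.assoc)
  also have "\<dots> = measure_pmf.expectation ?u (\<lambda>i. (norm (c + \<zeta> i))\<^sup>2 + real k * ?V)"
    by (simp only: Suc.IH)
  finally have step: "measure_pmf.expectation (sample n (Suc k)) (\<lambda>I. (norm (c + (\<Sum>i\<leftarrow>I. \<zeta> i)))\<^sup>2) =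
    measure_pmf.expectation ?u (\<lambda>i. (norm (c + \<zeta> i))\<^sup>2 + real k * ?V)" .
  have "measure_pmf.expectation ?u (\<lambda>i. (norm (c + \<zeta> i))\<^sup>2 + a) =
      (norm c)\<^sup>2 + ?V + 2 * (c \<bullet> (\<Sum>i=1..n. \<zeta> i)) / real n + a" for a
    using n unfolding sq by (simp add: expectation_uniform sum.distrib inner_sum_right
      sum_distrib_left add_divide_distrib del: One_nat_def)
  from this[of "real k * ?V"] show ?case
    unfolding step mean by (simp add: algebra_simps)
qed

text \<open>Both sources of randomness are instances: the minibatch of an inner step, where \<open>c\<close> is the error
of the snapshot gradient, and the batch of the snapshot gradient itself, where \<open>c = 0\<close>.\<close>

lemma expectation_norm_minibatch_error:
  fixes w :: "nat \<Rightarrow> 'a::real_inner"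
  assumes n: "n > 0" and k: "k > 0"
  defines "\<mu> \<equiv> (1 / real n) *\<^sub>R (\<Sum>i=1..n. w i)"
  shows "measure_pmf.expectation (sample n k)
           (\<lambda>I. (norm ((1 / real k) *\<^sub>R (\<Sum>i\<leftarrow>I. w i) - \<mu> + c))\<^sup>2) =
         (norm c)\<^sup>2 + measure_pmf.expectation (pmf_of_set {1..n}) (\<lambda>i. (norm (w i - \<mu>))\<^sup>2) / real k"
proof -
  have len: "length I = k" if "I \<in> set_pmf (sample n k)" for I
    using that by (simp add: sample_def set_replicate_pmf)
  have centred: "(\<Sum>i\<leftarrow>I. w i) = (\<Sum>i\<leftarrow>I. w i - \<mu>) + real (length I) *\<^sub>R \<mu>" for I
    by (induction I) (auto simp: algebra_simps)
  have eq: "(norm ((1 / real k) *\<^sub>R (\<Sum>i\<leftarrow>I. w i) - \<mu> + c))\<^sup>2 =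
        (norm (real k *\<^sub>R c + (\<Sum>i\<leftarrow>I. w i - \<mu>)))\<^sup>2 / (real k)\<^sup>2"
    if "I \<in> set_pmf (sample n k)" for I
  proof -
    have "(1 / real k) *\<^sub>R (\<Sum>i\<leftarrow>I. w i) - \<mu> + c = (1 / real k) *\<^sub>R (real k *\<^sub>R c + (\<Sum>i\<leftarrow>I. w i - \<mu>))"
      using k unfolding centred[of I] len[OF that] by (simp add: scaleR_right_distrib)
    then show ?thesis by (simp add: power_mult_distrib power_divide)
  qed
  have "measure_pmf.expectation (sample n k)
           (\<lambda>I. (norm ((1 / real k) *\<^sub>R (\<Sum>i\<leftarrow>I. w i) - \<mu> + c))\<^sup>2) =
        measure_pmf.expectation (sample n k)
           (\<lambda>I. (norm (real k *\<^sub>R c + (\<Sum>i\<leftarrow>I. w i - \<mu>)))\<^sup>2 / (real k)\<^sup>2)"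
    by (intro integral_cong_AE) (auto simp: AE_measure_pmf_iff eq)
  also have "\<dots> = ((norm (real k *\<^sub>R c))\<^sup>2 + real k *
      measure_pmf.expectation (pmf_of_set {1..n}) (\<lambda>i. (norm (w i - \<mu>))\<^sup>2)) / (real k)\<^sup>2"
  proof -
    have "(\<Sum>i=1..n. w i - \<mu>) = 0"
      using n by (simp add: sum_subtractf sum_constant_scaleR \<mu>_def del: sum_constant)
    from expectation_norm_sum_sample[OF n this, of k "real k *\<^sub>R c"] show ?thesis by simp
  qed
  also have "\<dots> = (norm c)\<^sup>2 + measure_pmf.expectation (pmf_of_set {1..n}) (\<lambda>i. (norm (w i - \<mu>))\<^sup>2) / real k"
    using k by (simp add: field_simps power2_eq_square)
  finally show ?thesis .
qed

lemma uniform_variance_le_second_moment: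
  fixes w :: "nat \<Rightarrow> 'a::real_inner"
  assumes n: "n > 0"
  defines "\<mu> \<equiv> (1 / real n) *\<^sub>R (\<Sum>i=1..n. w i)"
  shows "measure_pmf.expectation (pmf_of_set {1..n}) (\<lambda>i. (norm (w i - \<mu>))\<^sup>2) \<le>
         measure_pmf.expectation (pmf_of_set {1..n}) (\<lambda>i. (norm (w i))\<^sup>2)"
proof -
  have mu: "(\<Sum>i=1..n. w i) = real n *\<^sub>R \<mu>" using n by (simp add: \<mu>_def)
  have "(norm (w i - \<mu>))\<^sup>2 = (norm (w i))\<^sup>2 - 2 * (w i \<bullet> \<mu>) + (norm \<mu>)\<^sup>2" for i
    by (simp add: power2_norm_eq_inner algebra_simps inner_commute)
  then have "(\<Sum>i=1..n. (norm (w i - \<mu>))\<^sup>2) =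
     (\<Sum>i=1..n. (norm (w i))\<^sup>2) - 2 * ((\<Sum>i=1..n. w i) \<bullet> \<mu>) + real n * (norm \<mu>)\<^sup>2"
    by (simp add: sum.distrib sum_subtractf inner_sum_left sum_distrib_left)
  also have "\<dots> \<le> (\<Sum>i=1..n. (norm (w i))\<^sup>2)"
    unfolding mu by (simp add: power2_norm_eq_inner)
  finally show ?thesis using n by (simp add: expectation_uniform divide_right_mono del: One_nat_def)
qed

section \<open>Gradients and the descent inequality\<close>

lemma gradient_eqI:
  assumes "GDERIV f x :> D"
  shows "gradient f x = D"
proof -
  have "D' = D" if "GDERIV f x :> D'" for D'
  proof -
    have "(\<lambda>v. v \<bullet> D') = (\<lambda>v. v \<bullet> D)"
      using that assms unfolding gderiv_def by (rule has_derivative_unique)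
    then have "\<forall>v. v \<bullet> D' = v \<bullet> D" by (auto dest: fun_cong)
    then show ?thesis by (rule vector_eq_ldot[THEN iffD1])
  qed
  with assms show ?thesis unfolding gradient_def by (rule the_equality)
qed

lemma differentiable_imp_GDERIV_gradient:
  fixes f :: "'a::euclidean_space \<Rightarrow> real"
  assumes "f differentiable (at x)"
  shows "GDERIV f x :> gradient f x"
proof -
  from assms obtain f' where f': "(f has_derivative f') (at x)"
    unfolding differentiable_def by blast
  have "f' = (\<lambda>v. v \<bullet> adjoint f' 1)"
  proof
    show "f' v = v \<bullet> adjoint f' 1" for v
      using adjoint_works[OF has_derivative_linear[OF f'], of v 1] by simp
  qed
  then have deriv: "GDERIV f x :> adjoint f' 1"
    unfolding gderiv_def by (rule has_derivative_eq_rhs[OF f'])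
  show ?thesis
    unfolding gradient_eqI[OF deriv] by (rule deriv)
qed

text \<open>Along the segment from \<open>x\<close> to \<open>y\<close>, the function minus its quadratic upper model has a nonpositive
derivative, by the Lipschitz condition and the Cauchy-Schwarz inequality.\<close>

lemma descent_inequality:
  fixes f :: "'a::real_inner \<Rightarrow> real"
  assumes grad: "\<And>x. GDERIV f x :> gradient f x" and lip: "L-lipschitz_on UNIV (gradient f)"
  shows "f y \<le> f x + gradient f x \<bullet> (y - x) + L / 2 * (norm (y - x))\<^sup>2"
proof -
  define d where "d = y - x"
  define \<phi> where "\<phi> t = f (x + t *\<^sub>R d) - t * (gradient f x \<bullet> d) - t\<^sup>2 * (L / 2 * (norm d)\<^sup>2)" for t
  have "\<phi> 1 \<le> \<phi> 0"
  proof (rule DERIV_nonpos_imp_nonincreasing[where f = \<phi>])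
    fix t :: real assume t: "0 \<le> t" "t \<le> 1"
    let ?D = "gradient f (x + t *\<^sub>R d) \<bullet> d - gradient f x \<bullet> d - 2 * t * (L / 2 * (norm d)\<^sup>2)"
    have "(f has_derivative (\<lambda>v. v \<bullet> gradient f (x + t *\<^sub>R d))) (at (x + t *\<^sub>R d))"
      using grad unfolding gderiv_def .
    then have "((\<lambda>t. f (x + t *\<^sub>R d)) has_derivative (\<lambda>s. (s *\<^sub>R d) \<bullet> gradient f (x + t *\<^sub>R d))) (at t)"
      by (rule has_derivative_compose[rotated]) (auto intro!: derivative_eq_intros)
    then have "DERIV (\<lambda>t. f (x + t *\<^sub>R d)) t :> gradient f (x + t *\<^sub>R d) \<bullet> d"
      unfolding has_field_derivative_def
      by (rule has_derivative_eq_rhs) (simp add: fun_eq_iff inner_commute)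
    then have "DERIV \<phi> t :> ?D"
      unfolding \<phi>_def by (auto intro!: derivative_eq_intros)
    moreover have "?D \<le> 0"
    proof -
      have "gradient f (x + t *\<^sub>R d) \<bullet> d - gradient f x \<bullet> d
          \<le> norm (gradient f (x + t *\<^sub>R d) - gradient f x) * norm d"
        by (metis inner_diff_left norm_cauchy_schwarz)
      also have "\<dots> \<le> L * norm (t *\<^sub>R d) * norm d"
        using lipschitz_onD[OF lip, of "x + t *\<^sub>R d" x]
        by (intro mult_right_mono) (auto simp: dist_norm)
      finally show ?thesis using t by (simp add: power2_eq_square algebra_simps)
    qed
    ultimately show "\<exists>D. DERIV \<phi> t :> D \<and> D \<le> 0" by blast
  qed simp
  then show ?thesis by (simp add: \<phi>_def d_def)
qed

lemma GDERIV_average: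
  assumes "\<And>i. i \<in> {1..n} \<Longrightarrow> GDERIV (fs i) x :> gradient (fs i) x"
  shows "GDERIV (average n fs) x :> (1 / real n) *\<^sub>R (\<Sum>i=1..n. gradient (fs i) x)"
proof -
  have "((\<lambda>x. (1 / real n) * (\<Sum>i=1..n. fs i x)) has_derivative
     (\<lambda>v. (1 / real n) * (\<Sum>i=1..n. v \<bullet> gradient (fs i) x))) (at x)"
    using assms unfolding gderiv_def by (intro has_derivative_mult_right has_derivative_sum) auto
  then show ?thesis
    unfolding gderiv_def average_def[abs_def] by (simp add: inner_sum_right)
qed

lemma lipschitz_on_average_gradient:
  fixes fs :: "nat \<Rightarrow> 'a::real_inner \<Rightarrow> real"
  assumes n: "n > 0"
    and "\<And>i x. i \<in> {1..n} \<Longrightarrow> GDERIV (fs i) x :> gradient (fs i) x"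
    and lip: "\<And>i. i \<in> {1..n} \<Longrightarrow> L-lipschitz_on UNIV (gradient (fs i))"
  shows "L-lipschitz_on UNIV (gradient (average n fs))"
proof (rule lipschitz_onI)
  have grad: "gradient (average n fs) x = (1 / real n) *\<^sub>R (\<Sum>i=1..n. gradient (fs i) x)" for x
    using assms(2) by (intro gradient_eqI GDERIV_average)
  fix x y :: 'a
  have "norm (\<Sum>i=1..n. gradient (fs i) x - gradient (fs i) y) \<le> (\<Sum>i=1..n. L * dist x y)"
    using lipschitz_onD[OF lip] by (intro sum_norm_le) (auto simp: dist_norm)
  then show "dist (gradient (average n fs) x) (gradient (average n fs) y) \<le> L * dist x y"
    using n by (simp add: grad dist_norm flip: scaleR_diff_right sum_subtractf)
      (simp add: field_simps)
  show "0 \<le> L" using lipschitz_on_nonneg[OF lip, of 1] n by auto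
qed

section \<open>The proximal operator\<close>

lemma prox_minimal:
  "prox_well_defined \<eta> h \<Longrightarrow> prox_objective \<eta> h u (prox \<eta> h u) \<le> prox_objective \<eta> h u z"
  unfolding prox_well_defined_def prox_def arg_min_def
  by (metis (no_types, lifting) is_arg_min_linorder someI_ex)

text \<open>Since iterates after the first are values of the proximal operator, the algorithm never leaves
the domain of \<open>h\<close>, and its objective values can be treated as reals.\<close>

lemma prox_finite:
  assumes h: "prox_well_defined \<eta> h" "proper_fun h"
  shows "h (prox \<eta> h u) \<noteq> \<infinity>"
proof
  assume inf: "h (prox \<eta> h u) = \<infinity>"
  from h(2) obtain z where "h z \<noteq> \<infinity>" unfolding proper_fun_def by blast
  with prox_minimal[OF h(1), of u z] show False
    by (cases "h z") (auto simp: prox_objective_def inf)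
qed

text \<open>The proximal subproblem is \<open>1/\<eta>\<close>-strongly convex, so its value grows quadratically away from the
minimizer \<open>p\<close>. The proof compares \<open>p\<close> with the point \<open>q\<close> at parameter \<open>t\<close> on the segment
from \<open>p\<close> to \<open>z\<close> and lets \<open>t\<close> tend to \<open>0\<close>.\<close>

lemma prox_strong_minimality:
  fixes h :: "'a::real_inner \<Rightarrow> ereal" and u z :: 'a
  assumes \<eta>: "\<eta> > 0" and h: "prox_well_defined \<eta> h" "proper_fun h" "convex_fun h"
    and z: "h z \<noteq> \<infinity>"
  defines "p \<equiv> prox \<eta> h u"
  shows "real_of_ereal (h p) + (norm (p - u))\<^sup>2 / (2 * \<eta>) + (norm (z - p))\<^sup>2 / (2 * \<eta>)
       \<le> real_of_ereal (h z) + (norm (z - u))\<^sup>2 / (2 * \<eta>)"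
proof -
  let ?\<kappa> = "1 / (2 * \<eta>)"
  obtain a where a: "h p = ereal a"
    using prox_finite[OF h(1,2)] h(2) unfolding p_def proper_fun_def by (metis ereal_cases)
  obtain c where c: "h z = ereal c"
    using z h(2) unfolding proper_fun_def by (metis ereal_cases)
  \<comment> \<open>The variable \<open>s = 1 - t\<close> tends to \<open>1\<close>; in this form the limit needs no topology.\<close>
  have "s * (?\<kappa> * (norm (z - p))\<^sup>2) \<le> c + ?\<kappa> * (norm (z - u))\<^sup>2 - (a + ?\<kappa> * (norm (p - u))\<^sup>2)"
    if s: "0 < s" "s < 1" for s :: real
  proof -
    define t where "t = 1 - s"
    define q where "q = (1 - t) *\<^sub>R p + t *\<^sub>R z"
    have t: "0 < t" "t < 1" using s by (auto simp: t_def)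
    have "h q \<le> ereal (1 - t) * h p + ereal t * h z"
      using h(3) t unfolding convex_fun_def q_def by (meson atLeastAtMost_iff less_imp_le)
    also have "\<dots> = ereal ((1 - t) * a + t * c)" by (simp add: a c)
    finally have hq: "h q \<le> ereal ((1 - t) * a + t * c)" .
    have "ereal (a + ?\<kappa> * (norm (p - u))\<^sup>2) \<le> h q + ereal (?\<kappa> * (norm (q - u))\<^sup>2)"
      using prox_minimal[OF h(1), of u q] by (simp add: prox_objective_def a flip: p_def)
    also have "\<dots> \<le> ereal ((1 - t) * a + t * c) + ereal (?\<kappa> * (norm (q - u))\<^sup>2)"
      using hq by (rule add_right_mono)
    finally have *: "a + ?\<kappa> * (norm (p - u))\<^sup>2 \<le> (1 - t) * a + t * c + ?\<kappa> * (norm (q - u))\<^sup>2"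
      by simp
    have "(norm (q - u))\<^sup>2 =
        (1 - t) * (norm (p - u))\<^sup>2 + t * (norm (z - u))\<^sup>2 - t * (1 - t) * (norm (z - p))\<^sup>2"
      unfolding q_def power2_norm_eq_inner by (simp add: algebra_simps inner_commute)
    with * have "t * (s * (?\<kappa> * (norm (z - p))\<^sup>2)) \<le>
        t * (c + ?\<kappa> * (norm (z - u))\<^sup>2 - (a + ?\<kappa> * (norm (p - u))\<^sup>2))"
      unfolding t_def by (simp add: algebra_simps diff_divide_distrib add_divide_distrib)
    then show ?thesis using mult_le_cancel_left_pos[OF t(1)] by blast
  qed
  then have "?\<kappa> * (norm (z - p))\<^sup>2 \<le> c + ?\<kappa> * (norm (z - u))\<^sup>2 - (a + ?\<kappa> * (norm (p - u))\<^sup>2)"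
    by (rule field_le_mult_one_interval)
  then show ?thesis by (simp add: a c)
qed

section \<open>One proximal step\<close>

lemma norm_add_squared_le:
  fixes p q :: "'a::real_inner"
  assumes "\<beta> > 0"
  shows "(norm (p + q))\<^sup>2 \<le> (1 + 1 / \<beta>) * (norm p)\<^sup>2 + (1 + \<beta>) * (norm q)\<^sup>2"
proof -
  have "0 \<le> (norm (p - \<beta> *\<^sub>R q))\<^sup>2" by simp
  also have "\<dots> = (norm p)\<^sup>2 - 2 * \<beta> * (p \<bullet> q) + \<beta>\<^sup>2 * (norm q)\<^sup>2"
    unfolding power2_norm_eq_inner by (simp add: algebra_simps inner_commute power2_eq_square)
  finally have "2 * (p \<bullet> q) \<le> (norm p)\<^sup>2 / \<beta> + \<beta> * (norm q)\<^sup>2"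
    using assms by (simp add: field_simps power2_eq_square)
  moreover have "(norm (p + q))\<^sup>2 = (norm p)\<^sup>2 + 2 * (p \<bullet> q) + (norm q)\<^sup>2"
    by (simp add: power2_norm_eq_inner algebra_simps inner_commute)
  ultimately show ?thesis by (simp add: algebra_simps)
qed

text \<open>The gradient assumption is stated with \<open>GDERIV\<close>, which makes the analysis independent of the
dimension of the space.\<close>

locale composite_finite_sum =
  fixes n :: nat
    and fs :: "nat \<Rightarrow> 'a::real_inner \<Rightarrow> real"
    and h :: "'a \<Rightarrow> ereal"
    and L \<eta> :: real
  assumes n_pos: "n > 0"
    and L_pos: "L > 0"
    and eta_eq: "\<eta> = 1 / (6 * L)"
    and GDERIV_fs: "\<And>i x. i \<in> {1..n} \<Longrightarrow> GDERIV (fs i) x :> gradient (fs i) x"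
    and lipschitz_fs: "\<And>i. i \<in> {1..n} \<Longrightarrow> L-lipschitz_on UNIV (gradient (fs i))"
    and h_proper: "proper_fun h"
    and h_convex: "convex_fun h"
    and h_prox: "prox_well_defined \<eta> h"
begin

abbreviation "f \<equiv> average n fs"

text \<open>A real-valued form of the objective, meaningful on the domain of \<open>h\<close>, where all iterates lie.\<close>

definition \<Phi> :: "'a \<Rightarrow> real" where
  "\<Phi> x = f x + real_of_ereal (h x)"

definition gm_sq :: "'a \<Rightarrow> real" where
  "gm_sq x = (norm (gradient_mapping \<eta> f h x))\<^sup>2"

lemma eta_pos: "\<eta> > 0"
  using L_pos by (simp add: eta_eq)

lemma gradient_f: "gradient f x = (1 / real n) *\<^sub>R (\<Sum>i=1..n. gradient (fs i) x)"
  by (intro gradient_eqI GDERIV_average GDERIV_fs)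

lemma GDERIV_f: "GDERIV f x :> gradient f x"
  unfolding gradient_f by (intro GDERIV_average GDERIV_fs)

text \<open>Let \<open>z\<close> be the result of the exact proximal gradient step, so that \<open>x - z = \<eta> G x\<close>. Inequality 1
is the strong minimality of \<open>x'\<close> tested at \<open>z\<close>, inequality 2 that of \<open>z\<close> tested at \<open>x\<close>, and
inequality 3 the descent inequality from \<open>x\<close> to \<open>x'\<close>. In their sum the gradient error appears only
in \<open>\<langle>v - \<nabla>f x, z - x'\<rangle>\<close>, which inequality 4 bounds by Young's inequality, using up exactly the
term \<open>|z - x'|\<^sup>2 / (2\<eta>)\<close> from inequality 1.\<close>

lemma prox_step_descent:
  fixes x v :: 'a
  assumes x: "h x \<noteq> \<infinity>"
  defines "x' \<equiv> prox \<eta> h (x - \<eta> *\<^sub>R v)"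
  shows "\<Phi> x' + \<eta> / 2 * gm_sq x + 5 * L / 2 * (norm (x' - x))\<^sup>2
       \<le> \<Phi> x + \<eta> / 2 * (norm (v - gradient f x))\<^sup>2"
proof -
  let ?g = "gradient f x" and ?k = "1 / (2 * \<eta>)"
  define z where "z = prox \<eta> h (x - \<eta> *\<^sub>R ?g)"
  have z: "h z \<noteq> \<infinity>" unfolding z_def by (rule prox_finite[OF h_prox h_proper])
  \<comment> \<open>Completing the square: the proximal subproblem is the linear model of the gradient step plus a
    proximity term, up to a constant.\<close>
  have expand: "(norm (p - (x - \<eta> *\<^sub>R w)))\<^sup>2 / (2 * \<eta>) =
      ?k * (norm (p - x))\<^sup>2 + w \<bullet> (p - x) + \<eta> / 2 * (norm w)\<^sup>2" for p w
  proof -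
    have "(norm (p - (x - \<eta> *\<^sub>R w)))\<^sup>2 =
        (norm (p - x))\<^sup>2 + 2 * \<eta> * (w \<bullet> (p - x)) + \<eta>\<^sup>2 * (norm w)\<^sup>2"
      unfolding power2_norm_eq_inner
      by (simp add: algebra_simps inner_commute power2_eq_square)
    then show ?thesis using eta_pos by (simp add: field_simps power2_eq_square)
  qed
  have 1: "real_of_ereal (h x') + ?k * (norm (x' - x))\<^sup>2 + v \<bullet> (x' - x) + ?k * (norm (z - x'))\<^sup>2
      \<le> real_of_ereal (h z) + ?k * (norm (z - x))\<^sup>2 + v \<bullet> (z - x)"
    using prox_strong_minimality[OF eta_pos h_prox h_proper h_convex z, of "x - \<eta> *\<^sub>R v"]
    unfolding x'_def[symmetric] expand by simp
  have 2: "real_of_ereal (h z) + ?k * (norm (z - x))\<^sup>2 + ?g \<bullet> (z - x) + ?k * (norm (x - z))\<^sup>2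
      \<le> real_of_ereal (h x)"
    using prox_strong_minimality[OF eta_pos h_prox h_proper h_convex x, of "x - \<eta> *\<^sub>R ?g"]
    unfolding z_def[symmetric] expand by simp
  have 3: "f x' \<le> f x + ?g \<bullet> (x' - x) + L / 2 * (norm (x' - x))\<^sup>2"
    by (intro descent_inequality GDERIV_f lipschitz_on_average_gradient n_pos GDERIV_fs lipschitz_fs)
  have 4: "0 \<le> ?k * (norm (z - x'))\<^sup>2 - (v - ?g) \<bullet> (z - x') + \<eta> / 2 * (norm (v - ?g))\<^sup>2"
  proof -
    have "0 \<le> ?k * (norm ((z - x') - \<eta> *\<^sub>R (v - ?g)))\<^sup>2" using eta_pos by simp
    also have "(norm ((z - x') - \<eta> *\<^sub>R (v - ?g)))\<^sup>2 =
        (norm (z - x'))\<^sup>2 - 2 * \<eta> * ((v - ?g) \<bullet> (z - x')) + \<eta>\<^sup>2 * (norm (v - ?g))\<^sup>2"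
      unfolding power2_norm_eq_inner
      by (simp add: algebra_simps inner_commute power2_eq_square)
    finally show ?thesis using eta_pos by (simp add: field_simps power2_eq_square)
  qed
  have 5: "\<eta> / 2 * gm_sq x = ?k * (norm (x - z))\<^sup>2"
    using eta_pos unfolding gm_sq_def gradient_mapping_def z_def[symmetric]
    by (simp add: power_divide power2_eq_square)
  \<comment> \<open>This leaves the factor \<open>1/(2\<eta>) - L/2 = 5L/2\<close> in front of \<open>|x' - x|\<^sup>2\<close>.\<close>
  have k: "?k = 3 * L" using L_pos by (simp add: eta_eq)
  have "v \<bullet> (z - x) - v \<bullet> (x' - x) - ?g \<bullet> (z - x) + ?g \<bullet> (x' - x) = (v - ?g) \<bullet> (z - x')"
    by (simp add: algebra_simps)
  with 1 2 3 4 show ?thesis unfolding 5 \<Phi>_def k by (simp add: algebra_simps)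
qed

section \<open>Error of the variance reduced gradient\<close>

text \<open>The snapshot error \<open>g - \<nabla>f y\<close> is the same throughout an epoch, so it does not average out; but it is
fixed before the minibatch is drawn, so it is orthogonal to the minibatch error. The variance of the
latter is at most the second moment of the gradient differences, which smoothness bounds.\<close>

lemma expectation_estimator_error:
  assumes b: "b > 0"
  shows "measure_pmf.expectation (sample n b) (\<lambda>I. (norm ((1 / real b) *\<^sub>R
            (\<Sum>i\<leftarrow>I. gradient (fs i) x - gradient (fs i) y) + g - gradient f x))\<^sup>2)
       \<le> L\<^sup>2 / real b * (norm (x - y))\<^sup>2 + (norm (g - gradient f y))\<^sup>2"
proof -
  let ?w = "\<lambda>i. gradient (fs i) x - gradient (fs i) y"
  let ?\<mu> = "(1 / real n) *\<^sub>R (\<Sum>i=1..n. ?w i)"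
  have mu: "?\<mu> = gradient f x - gradient f y"
    by (simp add: gradient_f sum_subtractf algebra_simps)
  have "measure_pmf.expectation (sample n b) (\<lambda>I. (norm ((1 / real b) *\<^sub>R
            (\<Sum>i\<leftarrow>I. ?w i) + g - gradient f x))\<^sup>2)
      = measure_pmf.expectation (sample n b) (\<lambda>I. (norm ((1 / real b) *\<^sub>R
            (\<Sum>i\<leftarrow>I. ?w i) - ?\<mu> + (g - gradient f y)))\<^sup>2)"
    unfolding mu by (simp add: algebra_simps)
  also have "\<dots> = (norm (g - gradient f y))\<^sup>2 +
      measure_pmf.expectation (pmf_of_set {1..n}) (\<lambda>i. (norm (?w i - ?\<mu>))\<^sup>2) / real b"
    by (rule expectation_norm_minibatch_error[OF n_pos b])
  also have "\<dots> \<le> (norm (g - gradient f y))\<^sup>2 +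
      measure_pmf.expectation (pmf_of_set {1..n}) (\<lambda>i. (norm (?w i))\<^sup>2) / real b"
    by (intro add_left_mono divide_right_mono uniform_variance_le_second_moment n_pos) simp
  also have "\<dots> \<le> (norm (g - gradient f y))\<^sup>2 +
      measure_pmf.expectation (pmf_of_set {1..n}) (\<lambda>i. L\<^sup>2 * (norm (x - y))\<^sup>2) / real b"
  proof (intro add_left_mono divide_right_mono expectation_mono_finite)
    fix i assume "i \<in> set_pmf (pmf_of_set {1..n})"
    then have "i \<in> {1..n}" using n_pos by simp
    from lipschitz_onD[OF lipschitz_fs[OF this], of x y]
    have "norm (?w i) \<le> L * norm (x - y)" by (simp add: dist_norm)
    then have "(norm (?w i))\<^sup>2 \<le> (L * norm (x - y))\<^sup>2" by (rule power_mono) simp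
    then show "(norm (?w i))\<^sup>2 \<le> L\<^sup>2 * (norm (x - y))\<^sup>2" by (simp add: power_mult_distrib)
  qed (use n_pos in auto)
  finally show ?thesis by simp
qed

definition snapshot_error :: "nat \<Rightarrow> 'a \<Rightarrow> real" where
  "snapshot_error B y =
     measure_pmf.expectation (snapshot_gradient n fs B y) (\<lambda>g. (norm (g - gradient f y))\<^sup>2)"

lemma finite_snapshot_gradient: "finite (set_pmf (snapshot_gradient n fs B y))"
  using n_pos by (simp add: snapshot_gradient_def finite_set_pmf_sample)

lemma snapshot_error_full: "snapshot_error n y = 0"
  by (simp add: snapshot_error_def snapshot_gradient_def)

lemma snapshot_error_sampled:
  assumes B: "B > 0" "B \<noteq> n"
  shows "snapshot_error B y =
    measure_pmf.expectation (pmf_of_set {1..n}) (\<lambda>i. (norm (gradient (fs i) y - gradient f y))\<^sup>2) / real B"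
  using expectation_norm_minibatch_error[OF n_pos B(1), of "\<lambda>i. gradient (fs i) y" 0] B(2)
  unfolding gradient_f[symmetric] by (simp add: snapshot_error_def snapshot_gradient_def)

section \<open>Decrease of the energy along the algorithm\<close>

text \<open>A step is supposed to lower the objective by \<open>\<eta>/2 |G x|\<^sup>2\<close>, up to noise; adding these amounts
back gives a quantity that only noise can increase. As the objective is bounded below, a bound on the
expected energy at the end of the run bounds the expected sum of the \<open>|G x|\<^sup>2\<close>.\<close>

definition energy :: "'a svrg_state \<Rightarrow> real" where
  "energy st = \<Phi> (current st) + \<eta> / 2 * (\<Sum>x\<leftarrow>visited st. gm_sq x)"

lemma finite_inner_step: "finite (set_pmf (inner_step n fs h \<eta> b y g st))"
  using n_pos by (simp add: inner_step_def Let_def finite_set_pmf_sample)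

text \<open>The distance to the snapshot \<open>y\<close> is allowed to carry weight \<open>c'\<close> before the step and \<open>c\<close> after it.
Passing from \<open>|x - y|\<^sup>2\<close> to \<open>|x' - y|\<^sup>2\<close> costs a factor \<open>1 + 1/(4\<beta>)\<close> and a multiple of \<open>|x' - x|\<^sup>2\<close>,
which the descent of the step covers by the second condition on \<open>c\<close>. The summand \<open>L / (12 b)\<close> in the
condition on \<open>c'\<close> is \<open>\<eta>/2 \<cdot> L\<^sup>2/b\<close>, the contribution of the minibatch variance.\<close>

lemma inner_step_drift:
  assumes b: "b > 0" and x: "h (current st) \<noteq> \<infinity>"
    and c: "c \<ge> 0" "c * (1 + 4 * \<beta>) \<le> 5 * L / 2" and \<beta>: "\<beta> > 0"
    and c': "c * (1 + 1 / (4 * \<beta>)) + L / (12 * real b) \<le> c'"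
  shows "measure_pmf.expectation (inner_step n fs h \<eta> b y g st)
            (\<lambda>st'. energy st' + c * (norm (current st' - y))\<^sup>2)
       \<le> energy st + c' * (norm (current st - y))\<^sup>2 + \<eta> / 2 * (norm (g - gradient f y))\<^sup>2"
proof -
  define x where "x = current st"
  define v where "v I = (1 / real b) *\<^sub>R (\<Sum>i\<leftarrow>I. gradient (fs i) x - gradient (fs i) y) + g" for I
  define a where "a = energy st + c * (1 + 1 / (4 * \<beta>)) * (norm (x - y))\<^sup>2"
  have fin: "finite (set_pmf (sample n b))" by (rule finite_set_pmf_sample[OF n_pos])
  have "measure_pmf.expectation (inner_step n fs h \<eta> b y g st)
            (\<lambda>st'. energy st' + c * (norm (current st' - y))\<^sup>2) =
        measure_pmf.expectation (sample n b) (\<lambda>I.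
          \<Phi> (prox \<eta> h (x - \<eta> *\<^sub>R v I)) + \<eta> / 2 * ((\<Sum>x\<leftarrow>visited st. gm_sq x) + gm_sq x)
          + c * (norm (prox \<eta> h (x - \<eta> *\<^sub>R v I) - y))\<^sup>2)"
    unfolding inner_step_def Let_def
    by (subst expectation_bind_finite) (auto simp: fin energy_def v_def x_def)
  also have "\<dots> \<le> measure_pmf.expectation (sample n b)
      (\<lambda>I. a + \<eta> / 2 * (norm (v I - gradient f x))\<^sup>2)"
  proof (rule expectation_mono_finite[OF fin])
    fix I
    let ?x' = "prox \<eta> h (x - \<eta> *\<^sub>R v I)"
    have "(norm (?x' - y))\<^sup>2 \<le> (1 + 1 / (4 * \<beta>)) * (norm (x - y))\<^sup>2 + (1 + 4 * \<beta>) * (norm (?x' - x))\<^sup>2"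
      using norm_add_squared_le[of "4 * \<beta>" "x - y" "?x' - x"] \<beta> by simp
    then have "c * (norm (?x' - y))\<^sup>2 \<le>
        c * ((1 + 1 / (4 * \<beta>)) * (norm (x - y))\<^sup>2 + (1 + 4 * \<beta>) * (norm (?x' - x))\<^sup>2)"
      using c(1) by (rule mult_left_mono)
    also have "\<dots> = c * (1 + 1 / (4 * \<beta>)) * (norm (x - y))\<^sup>2 + c * (1 + 4 * \<beta>) * (norm (?x' - x))\<^sup>2"
      by (simp add: algebra_simps)
    also have "\<dots> \<le> c * (1 + 1 / (4 * \<beta>)) * (norm (x - y))\<^sup>2 + 5 * L / 2 * (norm (?x' - x))\<^sup>2"
      using c(2) by (intro add_left_mono mult_right_mono) auto
    finally have "c * (norm (?x' - y))\<^sup>2 \<le> \<dots>" .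
    moreover have "\<Phi> ?x' + \<eta> / 2 * gm_sq x + 5 * L / 2 * (norm (?x' - x))\<^sup>2
       \<le> \<Phi> x + \<eta> / 2 * (norm (v I - gradient f x))\<^sup>2"
      using x unfolding x_def by (rule prox_step_descent)
    ultimately show "\<Phi> ?x' + \<eta> / 2 * ((\<Sum>x\<leftarrow>visited st. gm_sq x) + gm_sq x) + c * (norm (?x' - y))\<^sup>2
        \<le> a + \<eta> / 2 * (norm (v I - gradient f x))\<^sup>2"
      unfolding a_def energy_def x_def[symmetric] distrib_left by linarith
  qed
  also have "\<dots> = a + \<eta> / 2 * measure_pmf.expectation (sample n b) (\<lambda>I. (norm (v I - gradient f x))\<^sup>2)"
    using fin by (simp add: integrable_measure_pmf_finite)
  also have "\<dots> \<le> a + \<eta> / 2 * (L\<^sup>2 / real b * (norm (x - y))\<^sup>2 + (norm (g - gradient f y))\<^sup>2)"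
    unfolding v_def using eta_pos by (intro add_left_mono mult_left_mono expectation_estimator_error b) auto
  also have "\<dots> = energy st + (c * (1 + 1 / (4 * \<beta>)) + L / (12 * real b)) * (norm (x - y))\<^sup>2
      + \<eta> / 2 * (norm (g - gradient f y))\<^sup>2"
    using L_pos b by (simp add: a_def eta_eq field_simps power2_eq_square)
  also have "\<dots> \<le> energy st + c' * (norm (x - y))\<^sup>2 + \<eta> / 2 * (norm (g - gradient f y))\<^sup>2"
    using c' by (intro add_right_mono add_left_mono mult_right_mono) auto
  finally show ?thesis by (simp add: x_def)
qed

definition inner_invariant :: "nat \<Rightarrow> 'a svrg_state \<Rightarrow> nat \<Rightarrow> 'a svrg_state \<Rightarrow> bool" where
  "inner_invariant b st t st' \<longleftrightarrow> h (current st') \<noteq> \<infinity> \<and>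
     length (visited st') = length (visited st) + t \<and>
     sfo_calls st' = sfo_calls st + t * b \<and> po_calls st' = po_calls st + t"

lemma inner_invariant_step:
  assumes "inner_invariant b st t st'"
  shows "finite (set_pmf (inner_step n fs h \<eta> b y g st')) \<and>
    (\<forall>st''\<in>set_pmf (inner_step n fs h \<eta> b y g st'). inner_invariant b st (Suc t) st'')"
proof (intro conjI finite_inner_step ballI)
  fix st'' assume "st'' \<in> set_pmf (inner_step n fs h \<eta> b y g st')"
  with assms prox_finite[OF h_prox h_proper] show "inner_invariant b st (Suc t) st''"
    by (auto simp: inner_step_def Let_def inner_invariant_def)
qed

text \<open>The weight on \<open>|x - y|\<^sup>2\<close> decreases linearly to \<open>0\<close>. Each step lowers it by \<open>L / (6 b)\<close>, of which
\<open>L / (12 b)\<close> pays for the minibatch variance and at most \<open>L / (24 b)\<close> for the growth factor with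
\<open>\<beta> = m\<close>. Since \<open>b = m\<^sup>2\<close>, the weights stay below \<open>L / (6 m)\<close>, small enough for the descent of
a single step. At the start of the epoch \<open>x = y\<close>, so the initial weight costs nothing.\<close>

lemma inner_loop_drift:
  assumes m: "m > 0" and b: "b = m\<^sup>2" and x: "h (current st) \<noteq> \<infinity>"
  shows "measure_pmf.expectation (iterate_pmf m (inner_step n fs h \<eta> b (current st) g) st) energy
       \<le> energy st + real m * (\<eta> / 2 * (norm (g - gradient f (current st)))\<^sup>2)"
proof -
  define c where "c t = L * (real m - real t) / (6 * real b)" for t
  let ?V = "\<lambda>t st'. energy st' + c t * (norm (current st' - current st))\<^sup>2"
  have "measure_pmf.expectation (iterate_pmf m (inner_step n fs h \<eta> b (current st) g) st) (?V m)
      \<le> ?V 0 st + real m * (\<eta> / 2 * (norm (g - gradient f (current st)))\<^sup>2)"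
  proof (rule iterate_pmf_expectation_le[where P = "inner_invariant b st"])
    show "inner_invariant b st 0 st" using x by (simp add: inner_invariant_def)
    fix t st' assume t: "t < m" and inv: "inner_invariant b st t st'"
    from inv show "finite (set_pmf (inner_step n fs h \<eta> b (current st) g st')) \<and>
      (\<forall>st''\<in>set_pmf (inner_step n fs h \<eta> b (current st) g st'). inner_invariant b st (Suc t) st'')"
      by (rule inner_invariant_step)
    have c_le: "c (Suc t) \<le> L / (6 * real m)"
    proof -
      have "c (Suc t) \<le> L * real m / (6 * real b)"
        unfolding c_def using L_pos by (intro divide_right_mono mult_left_mono) auto
      also have "\<dots> = L / (6 * real m)" using m by (simp add: b power2_eq_square)
      finally show ?thesis .
    qed
    show "measure_pmf.expectation (inner_step n fs h \<eta> b (current st) g st') (?V (Suc t))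
      \<le> ?V t st' + \<eta> / 2 * (norm (g - gradient f (current st)))\<^sup>2"
    proof (rule inner_step_drift[where \<beta> = "real m"])
      show "b > 0" "real m > 0" using m b by auto
      show "h (current st') \<noteq> \<infinity>" using inv by (simp add: inner_invariant_def)
      show "c (Suc t) \<ge> 0" using t L_pos by (simp add: c_def)
      have "c (Suc t) * (1 + 4 * real m) \<le> L / (6 * real m) * (5 * real m)"
        using c_le L_pos m by (intro mult_mono) auto
      also have "\<dots> \<le> 5 * L / 2" using L_pos m by simp
      finally show "c (Suc t) * (1 + 4 * real m) \<le> 5 * L / 2" .
      have "c (Suc t) / (4 * real m) \<le> L / (6 * real m) / (4 * real m)"
        using c_le by (intro divide_right_mono) auto
      also have "\<dots> = L / (24 * real b)" by (simp add: b power2_eq_square)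
      finally have "c (Suc t) / (4 * real m) \<le> L / (24 * real b)" .
      moreover have "c t = c (Suc t) + L / (6 * real b)"
        using m b by (simp add: c_def field_simps)
      moreover have "L / (24 * real b) + L / (12 * real b) \<le> L / (6 * real b)"
        using L_pos m b by (simp add: field_simps)
      ultimately show "c (Suc t) * (1 + 1 / (4 * real m)) + L / (12 * real b) \<le> c t"
        by (simp add: distrib_left)
    qed
  qed
  then show ?thesis by (simp add: c_def)
qed

text \<open>Counts relative to the start of the whole run, after \<open>s\<close> epochs; \<open>inner_invariant\<close> counts relative
to the state \<open>st\<close> at the start of an inner loop.\<close>

definition run_invariant :: "nat \<Rightarrow> nat \<Rightarrow> nat \<Rightarrow> nat \<Rightarrow> 'a svrg_state \<Rightarrow> bool" where
  "run_invariant B b m s st \<longleftrightarrow> h (current st) \<noteq> \<infinity> \<and> length (visited st) = s * m \<and>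
     sfo_calls st = s * (B + m * b) \<and> po_calls st = s * m"

lemma run_invariant_epoch:
  assumes inv: "run_invariant B b m s st"
  shows "finite (set_pmf (epoch n fs h \<eta> B b m st)) \<and>
    (\<forall>st'\<in>set_pmf (epoch n fs h \<eta> B b m st). run_invariant B b m (Suc s) st')"
proof -
  let ?st = "st\<lparr>sfo_calls := sfo_calls st + B\<rparr>"
  have "inner_invariant b ?st 0 ?st"
    using inv by (simp add: inner_invariant_def run_invariant_def)
  then have "finite (set_pmf (iterate_pmf m (inner_step n fs h \<eta> b (current st) g) ?st)) \<and>
    (\<forall>st'\<in>set_pmf (iterate_pmf m (inner_step n fs h \<eta> b (current st) g) ?st). inner_invariant b ?st m st')" for g
    by (rule iterate_pmf_finite_invariant) (rule inner_invariant_step)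
  with inv show ?thesis
    by (auto simp: epoch_def Let_def finite_snapshot_gradient inner_invariant_def run_invariant_def)
qed

lemma epoch_drift:
  assumes m: "m > 0" and b: "b = m\<^sup>2" and x: "h (current st) \<noteq> \<infinity>"
  shows "measure_pmf.expectation (epoch n fs h \<eta> B b m st) energy
       \<le> energy st + real m * (\<eta> / 2 * snapshot_error B (current st))"
proof -
  let ?p = "snapshot_gradient n fs B (current st)"
  let ?st = "st\<lparr>sfo_calls := sfo_calls st + B\<rparr>"
  let ?inner = "\<lambda>g. iterate_pmf m (inner_step n fs h \<eta> b (current st) g) ?st"
  have "inner_invariant b ?st 0 ?st" using x by (simp add: inner_invariant_def)
  then have fin: "finite (set_pmf (?inner g))" for g
    by (rule iterate_pmf_finite_invariant[THEN conjunct1]) (rule inner_invariant_step)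
  have "measure_pmf.expectation (epoch n fs h \<eta> B b m st) energy =
      measure_pmf.expectation ?p (\<lambda>g. measure_pmf.expectation (?inner g) energy)"
    by (simp add: epoch_def Let_def expectation_bind_finite finite_snapshot_gradient fin)
  also have "\<dots> \<le> measure_pmf.expectation ?p
      (\<lambda>g. energy st + real m * (\<eta> / 2 * (norm (g - gradient f (current st)))\<^sup>2))"
    using inner_loop_drift[OF m b, of ?st] x
    by (intro expectation_mono_finite finite_snapshot_gradient) (simp add: energy_def)
  also have "\<dots> = energy st + real m * (\<eta> / 2 * snapshot_error B (current st))"
    by (simp add: snapshot_error_def integrable_measure_pmf_finite finite_snapshot_gradient)
  finally show ?thesis .
qed

section \<open>The output of the algorithm\<close>

abbreviation run :: "'a \<Rightarrow> nat \<Rightarrow> nat \<Rightarrow> nat \<Rightarrow> nat \<Rightarrow> 'a svrg_state pmf" where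
  "run x0 B b m S \<equiv> iterate_pmf S (epoch n fs h \<eta> B b m)
     \<lparr>current = x0, visited = [], sfo_calls = 0, po_calls = 0\<rparr>"

lemma run_invariant_run:
  assumes "h x0 \<noteq> \<infinity>"
  shows "finite (set_pmf (run x0 B b m S))"
    and "st \<in> set_pmf (run x0 B b m S) \<Longrightarrow> run_invariant B b m S st"
proof -
  have "run_invariant B b m 0 \<lparr>current = x0, visited = [], sfo_calls = 0, po_calls = 0\<rparr>"
    using assms by (simp add: run_invariant_def)
  then have "finite (set_pmf (run x0 B b m S)) \<and>
      (\<forall>st\<in>set_pmf (run x0 B b m S). run_invariant B b m S st)"
    by (rule iterate_pmf_finite_invariant) (rule run_invariant_epoch)
  then show "finite (set_pmf (run x0 B b m S))"
    and "st \<in> set_pmf (run x0 B b m S) \<Longrightarrow> run_invariant B b m S st" by auto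
qed

lemma oracle_calls:
  assumes x0: "h x0 \<noteq> \<infinity>" and out: "(x, sfo, po) \<in> set_pmf (prox_svrg_plus n fs h x0 B b m \<eta> S)"
  shows "sfo = S * (B + m * b)" "po = S * m"
  using out run_invariant_run(2)[OF x0] by (auto simp: prox_svrg_plus_def run_invariant_def)

lemma expectation_output:
  assumes x0: "h x0 \<noteq> \<infinity>" and T: "S * m > 0"
  shows "measure_pmf.expectation (map_pmf fst (prox_svrg_plus n fs h x0 B b m \<eta> S)) gm_sq =
    measure_pmf.expectation (run x0 B b m S) (\<lambda>st. \<Sum>x\<leftarrow>visited st. gm_sq x) / real (S * m)"
proof -
  have avg: "measure_pmf.expectation (pmf_of_set {..<length xs}) (\<lambda>k. gm_sq (xs ! k)) =
      (\<Sum>x\<leftarrow>xs. gm_sq x) / real (length xs)" if "xs \<noteq> []" for xs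
    using that by (subst integral_pmf_of_set)
      (auto simp: sum_list_sum_nth atLeast0LessThan lessThan_empty_iff)
  have inv: "length (visited st) = S * m" if "st \<in> set_pmf (run x0 B b m S)" for st
    using run_invariant_run(2)[OF x0 that] by (simp add: run_invariant_def)
  have law: "map_pmf fst (prox_svrg_plus n fs h x0 B b m \<eta> S) =
      run x0 B b m S \<bind> (\<lambda>st. map_pmf (\<lambda>k. visited st ! k) (pmf_of_set {..<length (visited st)}))"
    by (simp add: prox_svrg_plus_def map_bind_pmf map_pmf_def bind_assoc_pmf bind_return_pmf)
  have "measure_pmf.expectation (map_pmf fst (prox_svrg_plus n fs h x0 B b m \<eta> S)) gm_sq =
      measure_pmf.expectation (run x0 B b m S) (\<lambda>st.
        measure_pmf.expectation (pmf_of_set {..<length (visited st)}) (\<lambda>k. gm_sq (visited st ! k)))"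
  proof -
    have "finite (set_pmf (pmf_of_set {..<length (visited st)}))" if "st \<in> set_pmf (run x0 B b m S)" for st
      using inv[OF that] T by (subst set_pmf_of_set) (auto simp: lessThan_empty_iff)
    then show ?thesis
      unfolding law by (subst expectation_bind_finite) (auto simp: run_invariant_run(1)[OF x0])
  qed
  also have "\<dots> = measure_pmf.expectation (run x0 B b m S) (\<lambda>st. (\<Sum>x\<leftarrow>visited st. gm_sq x) / real (S * m))"
  proof (intro integral_cong_AE)
    show "AE st in measure_pmf (run x0 B b m S).
      measure_pmf.expectation (pmf_of_set {..<length (visited st)}) (\<lambda>k. gm_sq (visited st ! k)) =
      (\<Sum>x\<leftarrow>visited st. gm_sq x) / real (S * m)"
      unfolding AE_measure_pmf_iff
    proof
      fix st assume "st \<in> set_pmf (run x0 B b m S)"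
      note len = inv[OF this]
      then have "visited st \<noteq> []" using T by auto
      from avg[OF this] len show "measure_pmf.expectation
        (pmf_of_set {..<length (visited st)}) (\<lambda>k. gm_sq (visited st ! k)) =
        (\<Sum>x\<leftarrow>visited st. gm_sq x) / real (S * m)" by simp
    qed
  qed simp_all
  finally show ?thesis by simp
qed

theorem expected_gradient_mapping_le:
  assumes S: "S > 0" and m: "m > 0" and b: "b = m\<^sup>2" and x0: "h x0 \<noteq> \<infinity>"
    and lower: "\<forall>x. h x \<noteq> \<infinity> \<longrightarrow> \<Phi>min \<le> \<Phi> x"
    and \<tau>: "\<And>y. snapshot_error B y \<le> \<tau>"
  shows "measure_pmf.expectation (map_pmf fst (prox_svrg_plus n fs h x0 B b m \<eta> S))
           (\<lambda>x. (norm (gradient_mapping \<eta> f h x))\<^sup>2)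
       \<le> 12 * L * (\<Phi> x0 - \<Phi>min) / real (S * m) + \<tau>"
proof -
  let ?st0 = "\<lparr>current = x0, visited = [], sfo_calls = 0, po_calls = 0\<rparr>"
  let ?sum = "\<lambda>st. \<Sum>x\<leftarrow>visited st. gm_sq x"
  let ?E = "measure_pmf.expectation (run x0 B b m S) ?sum"
  have T: "S * m > 0" using S m by simp
  have fin: "finite (set_pmf (run x0 B b m S))" by (rule run_invariant_run(1)[OF x0])
  \<comment> \<open>The last iterate still has objective value at least \<open>\<Phi>min\<close>; the rest of the energy is the sum.\<close>
  have "\<Phi>min + \<eta> / 2 * ?E = measure_pmf.expectation (run x0 B b m S) (\<lambda>st. \<Phi>min + \<eta> / 2 * ?sum st)"
    using fin by (simp add: integrable_measure_pmf_finite)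
  also have "\<dots> \<le> measure_pmf.expectation (run x0 B b m S) energy"
    using run_invariant_run(2)[OF x0]
    by (intro expectation_mono_finite fin) (auto simp: energy_def run_invariant_def lower)
  also have "\<dots> \<le> energy ?st0 + real S * (real m * (\<eta> / 2 * \<tau>))"
  proof (rule iterate_pmf_expectation_le[where V = "\<lambda>_. energy" and P = "run_invariant B b m"])
    show "run_invariant B b m 0 ?st0" using x0 by (simp add: run_invariant_def)
    fix s st assume inv: "run_invariant B b m s st"
    then show "finite (set_pmf (epoch n fs h \<eta> B b m st)) \<and>
      (\<forall>st'\<in>set_pmf (epoch n fs h \<eta> B b m st). run_invariant B b m (Suc s) st')"
      by (rule run_invariant_epoch)
    have "measure_pmf.expectation (epoch n fs h \<eta> B b m st) energy
       \<le> energy st + real m * (\<eta> / 2 * snapshot_error B (current st))"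
      using inv by (intro epoch_drift m b) (simp add: run_invariant_def)
    also have "\<dots> \<le> energy st + real m * (\<eta> / 2 * \<tau>)"
      using \<tau> eta_pos by (intro add_left_mono mult_left_mono) auto
    finally show "measure_pmf.expectation (epoch n fs h \<eta> B b m st) energy \<le> energy st + real m * (\<eta> / 2 * \<tau>)" .
  qed
  also have "energy ?st0 = \<Phi> x0" by (simp add: energy_def)
  finally have "\<eta> / 2 * ?E \<le> (\<Phi> x0 - \<Phi>min) + real (S * m) * (\<eta> / 2 * \<tau>)" by simp
  then have "?E \<le> 12 * L * (\<Phi> x0 - \<Phi>min) + real (S * m) * \<tau>"
    using L_pos by (simp add: eta_eq field_simps)
  then have "?E / real (S * m) \<le> (12 * L * (\<Phi> x0 - \<Phi>min) + real (S * m) * \<tau>) / real (S * m)"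
    using T by (intro divide_right_mono) auto
  also have "\<dots> = 12 * L * (\<Phi> x0 - \<Phi>min) / real (S * m) + \<tau>"
    using S m by (simp add: add_divide_distrib)
  finally have "measure_pmf.expectation (map_pmf fst (prox_svrg_plus n fs h x0 B b m \<eta> S)) gm_sq
      \<le> 12 * L * (\<Phi> x0 - \<Phi>min) / real (S * m) + \<tau>"
    by (simp only: expectation_output[OF x0 T])
  then show ?thesis by (simp add: gm_sq_def[abs_def])
qed

text \<open>With \<open>S\<close> rounded down, the bounds on the oracle calls hold because \<open>S\<close> is at most the ideal number
\<open>36 L \<Delta> / (\<epsilon> m)\<close>; accuracy holds because \<open>S\<close> is more than half of it, which makes the
optimization error at most \<open>2\<epsilon>/3\<close> and leaves \<open>\<epsilon>/3\<close> for the snapshot error.\<close>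

corollary exists_epoch_number:
  fixes \<epsilon> \<Delta> \<Phi>min :: real
  assumes \<epsilon>: "\<epsilon> > 0" and m: "m > 0" and b: "b = m\<^sup>2" and x0: "h x0 \<noteq> \<infinity>"
    and lower: "\<forall>x. h x \<noteq> \<infinity> \<longrightarrow> \<Phi>min \<le> \<Phi> x" and \<Delta>: "\<Delta> = \<Phi> x0 - \<Phi>min"
    and one_epoch: "1 \<le> 36 * L * \<Delta> / (\<epsilon> * real m)"
    and snapshot: "\<And>y. snapshot_error B y \<le> \<epsilon> / 3"
  shows "\<exists>S\<ge>1.
    eps_accurate \<epsilon> \<eta> f h (map_pmf fst (prox_svrg_plus n fs h x0 B b m \<eta> S)) \<and>
    (\<forall>(x, sfo, po) \<in> set_pmf (prox_svrg_plus n fs h x0 B b m \<eta> S).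
       real sfo \<le> 36 * L * \<Delta> * (real B / (\<epsilon> * sqrt (real b)) + real b / \<epsilon>) \<and>
       po = S * m \<and>
       real po \<le> 36 * L / \<epsilon> * \<Delta>)"
proof -
  let ?X = "36 * L * \<Delta> / (\<epsilon> * real m)"
  define S where "S = nat \<lfloor>?X\<rfloor>"
  have "1 \<le> \<lfloor>?X\<rfloor>" using one_epoch by (simp only: one_le_floor)
  then have S: "S \<ge> 1" "real S \<le> ?X" "?X < 2 * real S"
    unfolding S_def by linarith+
  have mult: "36 * L * \<Delta> / \<epsilon> = ?X * real m" using m by simp
  have calls: "real S * real m \<le> 36 * L * \<Delta> / \<epsilon>"
    unfolding mult using S(2) by (intro mult_right_mono) auto
  have "36 * L * \<Delta> / \<epsilon> < 2 * real (S * m)"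
    unfolding mult of_nat_mult mult.assoc[symmetric]
    using S(3) m by (intro mult_strict_right_mono) auto
  then have "12 * L * \<Delta> / real (S * m) \<le> 2 * \<epsilon> / 3"
    using \<epsilon> S(1) m by (simp add: field_simps)
  then have "eps_accurate \<epsilon> \<eta> f h (map_pmf fst (prox_svrg_plus n fs h x0 B b m \<eta> S))"
    using expected_gradient_mapping_le[OF _ m b x0 lower snapshot, of S] S(1)
    unfolding eps_accurate_def \<Delta> by simp
  moreover have "real sfo \<le> 36 * L * \<Delta> * (real B / (\<epsilon> * sqrt (real b)) + real b / \<epsilon>) \<and>
      po = S * m \<and> real po \<le> 36 * L / \<epsilon> * \<Delta>"
    if "(x, sfo, po) \<in> set_pmf (prox_svrg_plus n fs h x0 B b m \<eta> S)" for x sfo po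
  proof -
    have "real sfo = real S * real B + real S * real m * real b"
      using oracle_calls(1)[OF x0 that] by (simp add: algebra_simps)
    also have "\<dots> \<le> ?X * real B + 36 * L * \<Delta> / \<epsilon> * real b"
      using S(2) calls by (intro add_mono mult_right_mono) auto
    also have "\<dots> = 36 * L * \<Delta> * (real B / (\<epsilon> * sqrt (real b)) + real b / \<epsilon>)"
      by (simp add: b distrib_left)
    finally show ?thesis
      using oracle_calls(2)[OF x0 that] calls by simp
  qed
  ultimately show ?thesis using S(1) by blast
qed

end

section \<open>Oracle complexity\<close>

theorem theorem1:
  fixes n b m :: nat
    and fs :: "nat \<Rightarrow> real ^ 'd \<Rightarrow> real"
    and h :: "real ^ 'd \<Rightarrow> ereal"
    and L \<epsilon> \<eta> \<Delta> :: real
    and x0 xstar :: "real ^ 'd"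
  assumes L_pos: "L > 0"
    and f_diff: "\<And>i x. i \<in> {1..n} \<Longrightarrow> fs i differentiable (at x)"
    and f_smooth: "\<And>i. i \<in> {1..n} \<Longrightarrow> L-lipschitz_on UNIV (gradient (fs i))"
    and h_proper: "proper_fun h"
    and h_convex: "convex_fun h"
    and h_prox: "prox_well_defined \<eta> h"
    and xstar_min: "\<And>x. objective n fs h xstar \<le> objective n fs h x"
    and x0_dom: "h x0 \<noteq> \<infinity>"
    and Delta_def: "\<Delta> = real_of_ereal (objective n fs h x0 - objective n fs h xstar)"
    and eps_pos: "\<epsilon> > 0"
    and eta_def: "\<eta> = 1 / (6 * L)"
    and b_range: "b \<in> {1..n}"
    and m_def: "real m = sqrt (real b)"
    and one_epoch: "1 \<le> 36 * L * \<Delta> / (\<epsilon> * real m)"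
  shows
    "(\<forall>B. B = n \<longrightarrow>
        (\<exists>S\<ge>1.
           eps_accurate \<epsilon> \<eta> (average n fs) h (map_pmf fst (prox_svrg_plus n fs h x0 B b m \<eta> S)) \<and>
           (\<forall>(x, sfo, po) \<in> set_pmf (prox_svrg_plus n fs h x0 B b m \<eta> S).
              real sfo \<le> 36 * L * \<Delta> * (real B / (\<epsilon> * sqrt (real b)) + real b / \<epsilon>) \<and>
              po = S * m \<and>
              real po \<le> 36 * L / \<epsilon> * \<Delta>)) \<and>
        (\<lambda>(n', b', \<epsilon>'). 36 * L * \<Delta> * (real n' / (\<epsilon>' * sqrt (real b')) + real b' / \<epsilon>'))
          \<in> O[all_params](\<lambda>(n', b', \<epsilon>'). real n' / (\<epsilon>' * sqrt (real b')) + real b' / \<epsilon>')) \<and>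
     (\<forall>\<sigma> B.
        \<sigma> > 0 \<longrightarrow>
        (\<forall>x. measure_pmf.expectation (pmf_of_set {1..n})
               (\<lambda>i. (norm (gradient (fs i) x - gradient (average n fs) x))\<^sup>2) \<le> \<sigma>\<^sup>2) \<longrightarrow>
        real B = min (6 * \<sigma>\<^sup>2 / \<epsilon>) (real n) \<longrightarrow>
        (\<exists>S\<ge>1.
           eps_accurate \<epsilon> \<eta> (average n fs) h (map_pmf fst (prox_svrg_plus n fs h x0 B b m \<eta> S)) \<and>
           (\<forall>(x, sfo, po) \<in> set_pmf (prox_svrg_plus n fs h x0 B b m \<eta> S).
              real sfo \<le> 36 * L * \<Delta> * (real B / (\<epsilon> * sqrt (real b)) + real b / \<epsilon>) \<and>
              po = S * m \<and>
              real po \<le> 36 * L / \<epsilon> * \<Delta>)) \<and>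
        (\<lambda>(n', b', \<epsilon>'). 36 * L * \<Delta> *
            (min (6 * \<sigma>\<^sup>2 / \<epsilon>') (real n') / (\<epsilon>' * sqrt (real b')) + real b' / \<epsilon>'))
          \<in> O[all_params](\<lambda>(n', b', \<epsilon>').
              min (real n') (1 / \<epsilon>') * (1 / (\<epsilon>' * sqrt (real b'))) + real b' / \<epsilon>')) \<and>
     (\<lambda>\<epsilon>'. 36 * L / \<epsilon>' * \<Delta>) \<in> O[principal {0<..}](\<lambda>\<epsilon>'. 1 / \<epsilon>')"
proof -
  have n: "n > 0" using b_range by simp
  interpret composite_finite_sum n fs h L \<eta>
    by unfold_locales
      (use n L_pos eta_def f_diff f_smooth h_proper h_convex h_prox in
        \<open>auto intro: differentiable_imp_GDERIV_gradient\<close>)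
  have b: "b = m\<^sup>2"
  proof -
    have "(real m)\<^sup>2 = real b" unfolding m_def by simp
    then show ?thesis by (metis of_nat_eq_iff of_nat_power)
  qed
  have m: "m > 0" using b b_range by (cases "m = 0") auto
  have real_objective: "objective n fs h x = ereal (\<Phi> x)" if "h x \<noteq> \<infinity>" for x
    using that h_proper by (cases "h x") (auto simp: objective_def \<Phi>_def proper_fun_def)
  have xstar_dom: "h xstar \<noteq> \<infinity>"
  proof
    assume "h xstar = \<infinity>"
    then have "objective n fs h xstar = \<infinity>" by (simp add: objective_def)
    with xstar_min[of x0] show False by (simp add: real_objective[OF x0_dom])
  qed
  have lower: "\<forall>x. h x \<noteq> \<infinity> \<longrightarrow> \<Phi> xstar \<le> \<Phi> x"
    using xstar_min by (metis ereal_less_eq(3) real_objective xstar_dom)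
  have \<Delta>: "\<Delta> = \<Phi> x0 - \<Phi> xstar"
    unfolding Delta_def by (simp add: real_objective x0_dom xstar_dom)
  note complexity = exists_epoch_number[OF eps_pos m b x0_dom lower \<Delta> one_epoch]

  have full: "snapshot_error n y \<le> \<epsilon> / 3" for y
    using eps_pos by (simp add: snapshot_error_full)
  have bigo1: "(\<lambda>(n', b', \<epsilon>'). 36 * L * \<Delta> * (real n' / (\<epsilon>' * sqrt (real b')) + real b' / \<epsilon>'))
      \<in> O[all_params](\<lambda>(n', b', \<epsilon>'). real n' / (\<epsilon>' * sqrt (real b')) + real b' / \<epsilon>')"
    unfolding all_params_def
    by (rule bigoI[where c = "\<bar>36 * L * \<Delta>\<bar>"]) (auto simp: eventually_principal abs_mult)
  have sampled: "snapshot_error B y \<le> \<epsilon> / 3"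
    if \<sigma>: "\<sigma> > 0" and var: "\<forall>x. measure_pmf.expectation (pmf_of_set {1..n})
          (\<lambda>i. (norm (gradient (fs i) x - gradient (average n fs) x))\<^sup>2) \<le> \<sigma>\<^sup>2"
      and B: "real B = min (6 * \<sigma>\<^sup>2 / \<epsilon>) (real n)" for \<sigma> B y
  proof (cases "B = n")
    case True
    then show ?thesis using full by simp
  next
    case False
    then have B': "real B = 6 * \<sigma>\<^sup>2 / \<epsilon>" using B by linarith
    then have "B > 0" using \<sigma> eps_pos by (metis divide_pos_pos mult_pos_pos of_nat_0_less_iff zero_less_numeral zero_less_power)
    then have "snapshot_error B y \<le> \<sigma>\<^sup>2 / real B"
      using var False by (simp add: snapshot_error_sampled divide_right_mono del: One_nat_def)
    also have "\<dots> = \<epsilon> / 6" using \<sigma> eps_pos by (simp add: B')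
    finally show ?thesis using eps_pos by simp
  qed
  have bigo2: "(\<lambda>(n', b', \<epsilon>'). 36 * L * \<Delta> *
        (min (6 * \<sigma>\<^sup>2 / \<epsilon>') (real n') / (\<epsilon>' * sqrt (real b')) + real b' / \<epsilon>'))
      \<in> O[all_params](\<lambda>(n', b', \<epsilon>').
          min (real n') (1 / \<epsilon>') * (1 / (\<epsilon>' * sqrt (real b'))) + real b' / \<epsilon>')" for \<sigma> :: real
  proof -
    let ?K = "max 1 (6 * \<sigma>\<^sup>2)"
    have bound: "\<bar>36 * L * \<Delta> * (min (6 * \<sigma>\<^sup>2 / e) N / (e * sqrt c) + c / e)\<bar>
        \<le> \<bar>36 * L * \<Delta>\<bar> * ?K * \<bar>min N (1 / e) * (1 / (e * sqrt c)) + c / e\<bar>"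
      if pos: "N \<ge> 0" "c > 0" "e > 0" for N c e :: real
    proof -
      \<comment> \<open>The constant must serve all parameters at once: \<open>1\<close> suffices where the minimum on the right is
\<open>N\<close>, and \<open>6\<sigma>\<^sup>2\<close> where it is \<open>1/e\<close>.\<close>
      have "min (6 * \<sigma>\<^sup>2 / e) N \<le> ?K * min N (1 / e)"
      proof (cases "N \<le> 1 / e")
        case True
        have "1 * N \<le> ?K * N" using pos by (intro mult_right_mono) auto
        with True show ?thesis by simp
      next
        case False
        have "6 * \<sigma>\<^sup>2 * (1 / e) \<le> ?K * (1 / e)" using pos by (intro mult_right_mono) auto
        with False show ?thesis by simp
      qed
      then have "min (6 * \<sigma>\<^sup>2 / e) N * (1 / (e * sqrt c)) \<le> ?K * min N (1 / e) * (1 / (e * sqrt c))"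
        using pos by (intro mult_right_mono) auto
      moreover have "1 * (c / e) \<le> ?K * (c / e)" using pos by (intro mult_right_mono) auto
      ultimately have "min (6 * \<sigma>\<^sup>2 / e) N / (e * sqrt c) + c / e
          \<le> ?K * (min N (1 / e) * (1 / (e * sqrt c)) + c / e)"
        by (simp add: distrib_left)
      then have "\<bar>36 * L * \<Delta>\<bar> * (min (6 * \<sigma>\<^sup>2 / e) N / (e * sqrt c) + c / e)
          \<le> \<bar>36 * L * \<Delta>\<bar> * (?K * (min N (1 / e) * (1 / (e * sqrt c)) + c / e))"
        by (intro mult_left_mono) auto
      moreover have "0 \<le> min (6 * \<sigma>\<^sup>2 / e) N / (e * sqrt c) + c / e"
        "0 \<le> min N (1 / e) * (1 / (e * sqrt c)) + c / e"
        using pos by auto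
      ultimately show ?thesis by (simp only: abs_mult abs_of_nonneg mult.assoc)
    qed
    show ?thesis
      unfolding all_params_def
      by (rule bigoI[where c = "\<bar>36 * L * \<Delta>\<bar> * ?K"])
        (use bound in \<open>auto simp: eventually_principal\<close>)
  qed
  have bigo3: "(\<lambda>\<epsilon>'. 36 * L / \<epsilon>' * \<Delta>) \<in> O[principal {0<..}](\<lambda>\<epsilon>'. 1 / \<epsilon>')"
    by (rule bigoI[where c = "\<bar>36 * L * \<Delta>\<bar>"]) (auto simp: eventually_principal abs_mult)
  show ?thesis
    by (intro conjI allI impI bigo1 bigo2 bigo3 complexity) (simp only: full, rule sampled)
qed

end
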